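(* Let $\{x_n\}_{n\ge 1}$ and $\{y_n\}_{n\ge 1}$ be two sequences of real numbers, with $y_n\neq 0$ for all sufficiently large $n$, such that $x_n\sim y_n$ (that is, $x_n/y_n\to 1$ as $n\to\infty$). Suppose that, as $n\to+\infty$, $$\frac{x_n}{y_n}\bigg/\frac{x_{n-1}}{y_{n-1}}=\sum_{j=0}^{\infty}\frac{a_j}{n^j},\quad a_0=1,\ a_1=0,\qquad x_n=y_n\left(\sum_{j=0}^{\infty}\frac{b_j}{n^j}\right),$$ where $(a_j)_{j\ge 0}$ and $(b_j)_{j\ge 0}$ are real sequences and both expansions are understood as asymptotic power series. Then the coefficients $b_j$ are given by the recursive formula $$b_0=1,\qquad b_1=-a_2,\qquad b_k=-\frac1k\left[\sum_{j=0}^{k-1}c_j\,a_{k+1-j}+\sum_{j=1}^{k-1}\binom{k}{j-1}b_j\right],\quad k\ge 2,$$ where $c_0=1$ and $$c_i=\sum_{j=1}^{i}\binom{i-1}{j-1}b_j,\quad i=1,2,\ldots,k-1.$$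
   Context: An expansion $u_n=\sum_{j=0}^{\infty}\frac{a_j}{n^j}$ as $n\to+\infty$ is an asymptotic power series: for every integer $m\ge 0$, $u_n=\sum_{j=0}^{m}\frac{a_j}{n^j}+o\left(\frac{1}{n^m}\right)$ as $n\to\infty$ (convergence of the infinite series is not required). The relation $x_n=y_n\left(\sum_{j=0}^{\infty}\frac{b_j}{n^j}\right)$ means that $x_n/y_n$ has the asymptotic power series $\sum_{j=0}^{\infty}\frac{b_j}{n^j}$. Since $x_n/y_n\to 1$, the quotient $\frac{x_n}{y_n}\big/\frac{x_{n-1}}{y_{n-1}}$ is well defined for all sufficiently large $n$. *)

theory Defs
  imports Complex_Main "HOL-Library.Landau_Symbols"
begin

text \<open>
  Asymptotic power series in \<open>1 / n\<close>: no convergence of the infinite series is asked for.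
  Only large \<open>n\<close> matter, so the value \<open>u 0\<close> and the junk values of \<open>a j / 0 ^ j\<close> are irrelevant.
\<close>

definition has_asymp_power_series :: "(nat \<Rightarrow> real) \<Rightarrow> (nat \<Rightarrow> real) \<Rightarrow> bool" where
  "has_asymp_power_series u a \<longleftrightarrow>
     (\<forall>m. (\<lambda>n. u n - (\<Sum>j=0..m. a j / real n ^ j)) \<in> o(\<lambda>n. 1 / real n ^ m))"

text \<open>
  The numbers \<open>c\<^sub>i\<close>; they arise as the coefficients of the expansion obtained from
  \<open>\<Sum>j. b j / n ^ j\<close> (with \<open>b 0 = 1\<close>) by replacing \<open>n\<close> with \<open>n - 1\<close> and re-expanding in \<open>1 / n\<close>.
\<close>

definition c_coeff :: "(nat \<Rightarrow> real) \<Rightarrow> nat \<Rightarrow> real" where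
  "c_coeff b i = (if i = 0 then 1 else (\<Sum>j=1..i. real ((i - 1) choose (j - 1)) * b j))"

end

theory Submission
  imports Defs
begin

text \<open>
  Put \<open>u n = x n / y n\<close> and let \<open>q n = u n / u (n - 1)\<close>. For large \<open>n\<close> we have
  \<open>u n = u (n - 1) * q n\<close>, and both sides have an asymptotic power series in \<open>1 / n\<close>:

  \<^item> expanding \<open>1 / (n - 1) ^ (j + 1) = (\<Sum>l. (l choose j) / n ^ (l + 1))\<close> and
    substituting into the series of \<open>u\<close> shows that \<open>u (n - 1)\<close> has the coefficients
    \<open>c_coeff b\<close> (\<open>has_asymp_power_series_shift\<close>);
  \<^item> asymptotic power series multiply by the Cauchy product (\<open>has_asymp_power_series_mult\<close>);
  \<^item> their coefficients are unique (\<open>has_asymp_power_series_unique\<close>).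

  Comparing the coefficients of \<open>1 / n ^ (k + 1)\<close> therefore gives
  \<open>b (k + 1) = (\<Sum>i\<le>k + 1. c i * a (k + 1 - i))\<close>. Here \<open>a 0 = 1\<close> and \<open>a 1 = 0\<close> reduce the last
  two summands to \<open>c (k + 1)\<close>, and \<open>c (k + 1)\<close> itself ends in \<open>k * b k + b (k + 1)\<close>. So
  \<open>b (k + 1)\<close> cancels, and what remains is an equation for \<open>b k\<close> in terms of earlier
  coefficients. For \<open>k = 1\<close> it is \<open>b 1 = - a 2\<close>.
\<close>

section \<open>Asymptotic power series\<close>

lemma has_asymp_power_seriesI:
  assumes "\<And>m. (\<lambda>n. u n - (\<Sum>j\<le>m. a j / real n ^ j)) \<in> o(\<lambda>n. 1 / real n ^ m)"
  shows "has_asymp_power_series u a"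
  using assms by (simp add: has_asymp_power_series_def atLeast0AtMost)

lemma has_asymp_power_seriesD:
  assumes "has_asymp_power_series u a"
  shows "(\<lambda>n. u n - (\<Sum>j\<le>m. a j / real n ^ j)) \<in> o(\<lambda>n. 1 / real n ^ m)"
  using assms by (simp add: has_asymp_power_series_def atLeast0AtMost)

lemma has_asymp_power_series_cong:
  assumes "\<forall>\<^sub>F n in sequentially. u n = v n" and "has_asymp_power_series u a"
  shows "has_asymp_power_series v a"
proof (rule has_asymp_power_seriesI)
  fix m
  have "\<forall>\<^sub>F n in sequentially. v n - (\<Sum>j\<le>m. a j / real n ^ j) = u n - (\<Sum>j\<le>m. a j / real n ^ j)"
    using assms(1) by eventually_elim simp
  then show "(\<lambda>n. v n - (\<Sum>j\<le>m. a j / real n ^ j)) \<in> o(\<lambda>n. 1 / real n ^ m)"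
    using has_asymp_power_seriesD[OF assms(2)] by (subst landau_o.small.in_cong)
qed

lemma inverse_power_smallo:
  assumes "m < k"
  shows "(\<lambda>n. c / real n ^ k) \<in> o(\<lambda>n. 1 / real n ^ m)"
proof -
  have "(\<lambda>n. c / real n ^ (k - m)) \<longlonglongrightarrow> 0"
    using assms by (intro real_tendsto_divide_at_top[OF tendsto_const] filterlim_pow_at_top
        filterlim_real_sequentially) simp
  moreover have "\<forall>\<^sub>F n in sequentially. (c / real n ^ k) / (1 / real n ^ m) = c / real n ^ (k - m)"
    using eventually_gt_at_top[of 0] by eventually_elim (use assms in \<open>simp add: power_diff\<close>)
  ultimately have "(\<lambda>n. (c / real n ^ k) / (1 / real n ^ m)) \<longlonglongrightarrow> 0"
    by (simp cong: tendsto_cong)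
  then show ?thesis
    by (rule smalloI_tendsto) (use eventually_gt_at_top[of 0] in \<open>eventually_elim, simp\<close>)
qed

lemma const_div_power_smalloD:
  assumes "(\<lambda>n::nat. c / real n ^ m) \<in> o(\<lambda>n. 1 / real n ^ m)"
  shows "c = 0"
proof -
  have "(\<lambda>n. (c / real n ^ m) / (1 / real n ^ m)) \<longlonglongrightarrow> 0"
    using assms by (rule smalloD_tendsto)
  moreover have "\<forall>\<^sub>F n in sequentially. (c / real n ^ m) / (1 / real n ^ m) = c"
    using eventually_gt_at_top[of 0] by eventually_elim simp
  ultimately have "(\<lambda>n::nat. c) \<longlonglongrightarrow> 0"
    by (simp cong: tendsto_cong)
  then show ?thesis by (simp add: LIMSEQ_const_iff)
qed

text \<open>
  Once all earlier coefficients agree, subtracting the two truncations at order \<open>m\<close> leaves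
  \<open>(a m - b m) / n ^ m\<close>, which is \<open>o(1 / n ^ m)\<close> only if it vanishes.
\<close>
lemma has_asymp_power_series_unique:
  assumes "has_asymp_power_series u a" and "has_asymp_power_series u b"
  shows "a m = b m"
proof (induction m rule: less_induct)
  case (less m)
  have "(\<lambda>n. (u n - (\<Sum>j\<le>m. b j / real n ^ j)) - (u n - (\<Sum>j\<le>m. a j / real n ^ j)))
      \<in> o(\<lambda>n. 1 / real n ^ m)"
    by (intro sum_in_smallo has_asymp_power_seriesD assms)
  moreover have "(u n - (\<Sum>j\<le>m. b j / real n ^ j)) - (u n - (\<Sum>j\<le>m. a j / real n ^ j))
      = (a m - b m) / real n ^ m" for n
  proof -
    have "(\<Sum>j<m. a j / real n ^ j) = (\<Sum>j<m. b j / real n ^ j)"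
      using less by simp
    then show ?thesis
      by (simp add: lessThan_Suc_atMost[symmetric] diff_divide_distrib)
  qed
  ultimately show ?case
    using const_div_power_smalloD[of "a m - b m" m] by simp
qed

lemma has_asymp_power_series_tendsto:
  assumes "has_asymp_power_series u a"
  shows "u \<longlonglongrightarrow> a 0"
  using smalloD_tendsto[OF has_asymp_power_seriesD[OF assms, of 0]]
  by (simp add: LIM_zero_iff)

text \<open>
  Truncate both series at order \<open>m\<close>. The product of the two polynomials in \<open>1 / n\<close> differs
  from the truncated Cauchy product exactly by the terms with \<open>i + j > m\<close>, each of which is
  \<open>o(1 / n ^ m)\<close>.
\<close>
lemma has_asymp_power_series_mult:
  assumes u: "has_asymp_power_series u a" and v: "has_asymp_power_series v b"
  shows "has_asymp_power_series (\<lambda>n. u n * v n) (\<lambda>k. \<Sum>i\<le>k. a i * b (k - i))"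
proof (rule has_asymp_power_seriesI)
  fix m
  define A where "A n = (\<Sum>j\<le>m. a j / real n ^ j)" for n
  define B where "B n = (\<Sum>j\<le>m. b j / real n ^ j)" for n
  let ?L = "{(i, j). i + j \<le> m}" and ?H = "{(i, j). i \<le> m \<and> j \<le> m \<and> m < i + j}"
  let ?t = "\<lambda>n (i, j). a i * b j / real n ^ (i + j)"
  have fin: "finite ?L" "finite ?H"
    by (rule finite_subset[of _ "{..m} \<times> {..m}"]; auto)+
  have uA: "(\<lambda>n. u n - A n) \<in> o(\<lambda>n. 1 / real n ^ m)"
    and vB: "(\<lambda>n. v n - B n) \<in> o(\<lambda>n. 1 / real n ^ m)"
    using has_asymp_power_seriesD[OF u] has_asymp_power_seriesD[OF v] by (simp_all add: A_def B_def)
  have v1: "v \<in> O(\<lambda>_. 1)"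
    using has_asymp_power_series_tendsto[OF v] by (intro bigoI_tendsto) auto
  have "(\<lambda>n. a j / real n ^ j) \<in> O(\<lambda>_. 1)" for j
    using inverse_power_smallo[of 0 j "a j"]
    by (cases "j = 0") (auto intro: landau_o.small_imp_big)
  then have A1: "A \<in> O(\<lambda>_. 1)"
    unfolding A_def by (intro big_sum_in_bigo)
  have "(\<lambda>n. (u n - A n) * v n) \<in> o(\<lambda>n. 1 / real n ^ m)"
    using landau_o.small_big_mult[OF uA v1] by simp
  moreover have "(\<lambda>n. A n * (v n - B n)) \<in> o(\<lambda>n. 1 / real n ^ m)"
    using landau_o.big_small_mult[OF A1 vB] by simp
  moreover have "(\<lambda>n. \<Sum>p\<in>?H. ?t n p) \<in> o(\<lambda>n. 1 / real n ^ m)"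
    by (intro big_sum_in_smallo) (auto intro: inverse_power_smallo)
  ultimately have "(\<lambda>n. (u n - A n) * v n + A n * (v n - B n) + (\<Sum>p\<in>?H. ?t n p))
      \<in> o(\<lambda>n. 1 / real n ^ m)"
    by (intro sum_in_smallo)
  moreover have "u n * v n - (\<Sum>k\<le>m. (\<Sum>i\<le>k. a i * b (k - i)) / real n ^ k)
      = (u n - A n) * v n + A n * (v n - B n) + (\<Sum>p\<in>?H. ?t n p)" for n
  proof -
    have "A n * B n = (\<Sum>p\<in>{..m} \<times> {..m}. ?t n p)"
      by (simp add: A_def B_def sum_product sum.cartesian_product power_add)
    also have "{..m} \<times> {..m} = ?L \<union> ?H"
      by auto
    also have "(\<Sum>p\<in>?L \<union> ?H. ?t n p) = (\<Sum>p\<in>?L. ?t n p) + (\<Sum>p\<in>?H. ?t n p)"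
      using fin by (intro sum.union_disjoint) auto
    also have "(\<Sum>p\<in>?L. ?t n p) = (\<Sum>k\<le>m. \<Sum>i\<le>k. a i * b (k - i) / real n ^ (i + (k - i)))"
      by (rule sum.triangle_reindex_eq)
    also have "\<dots> = (\<Sum>k\<le>m. (\<Sum>i\<le>k. a i * b (k - i)) / real n ^ k)"
      by (simp add: sum_divide_distrib)
    finally show ?thesis
      by (simp add: algebra_simps)
  qed
  ultimately show "(\<lambda>n. u n * v n - (\<Sum>k\<le>m. (\<Sum>i\<le>k. a i * b (k - i)) / real n ^ k))
      \<in> o(\<lambda>n. 1 / real n ^ m)"
    by simp
qed

section \<open>Re-expansion after an index shift\<close>

text \<open>
  The geometric series: truncating \<open>1 / (n - 1)\<close> after \<open>m\<close> terms leaves exactly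
  \<open>1 / ((n - 1) * n ^ m)\<close>.
\<close>
lemma has_asymp_power_series_inverse_pred:
  "has_asymp_power_series (\<lambda>n. 1 / real (n - 1)) (case_nat 0 (\<lambda>_. 1))"
proof (rule has_asymp_power_seriesI)
  fix m
  have rem: "1 / real (n - 1) - (\<Sum>j\<le>m. case_nat 0 (\<lambda>_. 1) j / real n ^ j)
      = 1 / real (n - 1) * (1 / real n ^ m)" if "n > 1" for n
  proof (induction m)
    case (Suc m)
    have "1 / real (n - 1) * (1 / real n ^ m) - 1 / real n ^ Suc m
        = 1 / real (n - 1) * (1 / real n ^ Suc m)"
      using that by (simp add: divide_simps of_nat_diff)
    with Suc show ?case
      by simp
  qed simp
  have "(\<lambda>n. 1 / real (n - 1)) \<longlonglongrightarrow> 0"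
    by (intro real_tendsto_divide_at_top[OF tendsto_const]
        filterlim_compose[OF filterlim_real_sequentially] filterlim_minus_const_nat_at_top)
  then have "(\<lambda>n. 1 / real (n - 1)) \<in> o(\<lambda>_. 1)"
    by (intro smalloI_tendsto) auto
  then have "(\<lambda>n. 1 / real (n - 1) * (1 / real n ^ m)) \<in> o(\<lambda>n. 1 * (1 / real n ^ m))"
    by (intro landau_o.small_big_mult) auto
  moreover have "\<forall>\<^sub>F n in sequentially.
      1 / real (n - 1) - (\<Sum>j\<le>m. case_nat 0 (\<lambda>_. 1) j / real n ^ j)
        = 1 / real (n - 1) * (1 / real n ^ m)"
    using eventually_gt_at_top[of 1] by eventually_elim (rule rem)
  ultimately show "(\<lambda>n. 1 / real (n - 1) - (\<Sum>j\<le>m. case_nat 0 (\<lambda>_. 1) j / real n ^ j))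
      \<in> o(\<lambda>n. 1 / real n ^ m)"
    by (simp add: landau_o.small.in_cong)
qed

text \<open>
  Multiplication by \<open>1 / (n - 1)\<close> turns the coefficients into their partial sums, and by
  the hockey-stick identity the partial sums of a column of Pascal's triangle form the next one.
\<close>
lemma has_asymp_power_series_inverse_pred_power:
  "has_asymp_power_series (\<lambda>n. 1 / real (n - 1) ^ Suc j) (case_nat 0 (\<lambda>l. real (l choose j)))"
proof (induction j)
  case 0
  show ?case
    unfolding binomial_n_0 of_nat_1 using has_asymp_power_series_inverse_pred by simp
next
  case (Suc j)
  let ?p = "case_nat 0 (\<lambda>l. real (l choose j))" and ?q = "case_nat 0 (\<lambda>_. 1) :: nat \<Rightarrow> real"
  have "(\<Sum>i\<le>k. ?p i * ?q (k - i)) = case_nat 0 (\<lambda>l. real (l choose Suc j)) k" for k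
  proof (cases k)
    case (Suc l)
    have "(\<Sum>i\<le>k. ?p i * ?q (k - i)) = (\<Sum>i\<le>l. real (i choose j) * ?q (l - i))"
      by (simp add: Suc sum.atMost_Suc_shift del: sum.atMost_Suc)
    also have "\<dots> = (\<Sum>i<l. real (i choose j) * ?q (l - i))"
      by (simp add: lessThan_Suc_atMost[symmetric])
    also have "\<dots> = (\<Sum>i<l. real (i choose j))"
      by (intro sum.cong) (auto split: nat.split)
    also have "\<dots> = real (l choose Suc j)"
      by (induction l) auto
    finally show ?thesis
      by (simp add: Suc)
  qed simp
  then show ?case
    using has_asymp_power_series_mult[OF Suc has_asymp_power_series_inverse_pred] by (simp add: mult.commute)
qed

text \<open>
  The truncation of \<open>u (n - 1)\<close> at order \<open>m\<close> is \<open>b 0\<close> plus a finite combination of the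
  powers \<open>1 / (n - 1) ^ Suc j\<close>, and each of these may be replaced by its own expansion. The remainder
  survives the shift because \<open>1 / (n - 1) \<le> 2 / n\<close> for \<open>n \<ge> 2\<close>. When \<open>b 0 = 1\<close>, the resulting
  coefficients are those of \<open>c_coeff b\<close>.
\<close>
lemma has_asymp_power_series_shift:
  assumes "has_asymp_power_series u b"
  shows "has_asymp_power_series (\<lambda>n. u (n - 1))
    (case_nat (b 0) (\<lambda>l. \<Sum>j\<le>l. real (l choose j) * b (Suc j)))" (is "has_asymp_power_series _ ?c")
proof (rule has_asymp_power_seriesI)
  fix m
  let ?p = "\<lambda>j. case_nat 0 (\<lambda>l. real (l choose j))"
  let ?r = "\<lambda>j n. 1 / real (n - 1) ^ Suc j - (\<Sum>i\<le>m. ?p j i / real n ^ i)"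
  have "(\<lambda>n. u (n - 1) - (\<Sum>j\<le>m. b j / real (n - 1) ^ j)) \<in> o(\<lambda>n. 1 / real (n - 1) ^ m)"
    using has_asymp_power_seriesD[OF assms]
    by (rule landau_o.small.compose) (rule filterlim_minus_const_nat_at_top)
  also have "(\<lambda>n. 1 / real (n - 1) ^ m) \<in> O(\<lambda>n. 1 / real n ^ m)"
  proof -
    have "(\<lambda>n. 1 / real (n - 1)) \<in> O(\<lambda>n. 1 / real n)"
    proof (rule bigoI)
      show "\<forall>\<^sub>F n in sequentially. norm (1 / real (n - 1)) \<le> 2 * norm (1 / real n)"
        using eventually_gt_at_top[of 1]
        by eventually_elim (simp add: field_simps of_nat_diff)
    qed
    from landau_o.big_power[OF this, of m] show ?thesis
      by (simp add: power_one_over)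
  qed
  finally have "(\<lambda>n. u (n - 1) - (\<Sum>j\<le>m. b j / real (n - 1) ^ j)) \<in> o(\<lambda>n. 1 / real n ^ m)" .
  moreover have "(\<lambda>n. \<Sum>j<m. b (Suc j) * ?r j n) \<in> o(\<lambda>n. 1 * (1 / real n ^ m))"
    by (intro big_sum_in_smallo landau_o.big_small_mult bigo_const
        has_asymp_power_seriesD has_asymp_power_series_inverse_pred_power)
  ultimately have "(\<lambda>n. (u (n - 1) - (\<Sum>j\<le>m. b j / real (n - 1) ^ j))
      + (\<Sum>j<m. b (Suc j) * ?r j n)) \<in> o(\<lambda>n. 1 / real n ^ m)"
    unfolding mult_1_left by (rule sum_in_smallo)
  moreover have "(u (n - 1) - (\<Sum>j\<le>m. b j / real (n - 1) ^ j)) + (\<Sum>j<m. b (Suc j) * ?r j n)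
      = u (n - 1) - (\<Sum>i\<le>m. ?c i / real n ^ i)" for n
  proof -
    have "(\<Sum>j<m. b (Suc j) * (\<Sum>i\<le>m. ?p j i / real n ^ i))
        = (\<Sum>j<m. \<Sum>l<m. b (Suc j) * real (l choose j) / real n ^ Suc l)"
      by (simp add: sum.atMost_shift sum_distrib_left)
    also have "\<dots> = (\<Sum>l<m. \<Sum>j<m. b (Suc j) * real (l choose j) / real n ^ Suc l)"
      by (rule sum.swap)
    \<comment> \<open>Truncating the outer series at \<open>m\<close> loses nothing up to order \<open>m\<close>, as
        \<open>l choose j\<close> vanishes for \<open>j > l\<close>.\<close>
    also have "\<dots> = (\<Sum>l<m. \<Sum>j\<le>l. b (Suc j) * real (l choose j) / real n ^ Suc l)"
      by (intro sum.cong sum.mono_neutral_right) auto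
    finally have re: "(\<Sum>j<m. b (Suc j) * (\<Sum>i\<le>m. ?p j i / real n ^ i))
        = (\<Sum>l<m. ?c (Suc l) / real n ^ Suc l)"
      by (simp add: sum_divide_distrib mult.commute)
    have "(\<Sum>j<m. b (Suc j) * ?r j n) = (\<Sum>j<m. b (Suc j) / real (n - 1) ^ Suc j)
        - (\<Sum>j<m. b (Suc j) * (\<Sum>i\<le>m. ?p j i / real n ^ i))"
      by (simp add: right_diff_distrib sum_subtractf)
    then show ?thesis
      unfolding re by (simp add: sum.atMost_shift)
  qed
  ultimately show "(\<lambda>n. u (n - 1) - (\<Sum>i\<le>m. ?c i / real n ^ i)) \<in> o(\<lambda>n. 1 / real n ^ m)"
    by (simp only:)
qed

lemma c_coeff_Suc: "c_coeff b (Suc l) = (\<Sum>j\<le>l. real (l choose j) * b (Suc j))"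
  by (simp add: c_coeff_def sum.shift_bounds_cl_Suc_ivl atLeast0AtMost del: sum.cl_ivl_Suc)

section \<open>The recursion for the coefficients\<close>

theorem theorem3p3:
  fixes x y a b :: "nat \<Rightarrow> real"
  assumes y_nz: "\<forall>\<^sub>F n in sequentially. y n \<noteq> 0"
    and equiv: "x \<sim>[sequentially] y"
    and quot: "has_asymp_power_series (\<lambda>n. (x n / y n) / (x (n - 1) / y (n - 1))) a"
    and a0: "a 0 = 1"
    and a1: "a 1 = 0"
    and expansion: "has_asymp_power_series (\<lambda>n. x n / y n) b"
  shows "b 0 = 1 \<and> b 1 = - a 2 \<and>
    (\<forall>k\<ge>2. b k = - (1 / real k) *
       ((\<Sum>j=0..k - 1. c_coeff b j * a (k + 1 - j)) +
        (\<Sum>j=1..k - 1. real (k choose (j - 1)) * b j)))"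
proof -
  define u where "u n = x n / y n" for n
  have u: "has_asymp_power_series u b"
    using expansion by (simp add: u_def[abs_def])
  have "u \<longlonglongrightarrow> 1"
    unfolding u_def using equiv y_nz
    by (intro asymp_equivD_strong) (auto elim: eventually_mono)
  with has_asymp_power_series_tendsto[OF u] have b0: "b 0 = 1"
    by (rule LIMSEQ_unique)
  have "case_nat (b 0) (\<lambda>l. \<Sum>j\<le>l. real (l choose j) * b (Suc j)) i = c_coeff b i" for i
    by (cases i) (simp_all add: b0 c_coeff_Suc, simp add: c_coeff_def)
  then have shift: "has_asymp_power_series (\<lambda>n. u (n - 1)) (c_coeff b)"
    using has_asymp_power_series_shift[OF u] by presburger
  have "\<forall>\<^sub>F n in sequentially. u n \<noteq> 0"
    using \<open>u \<longlonglongrightarrow> 1\<close> by (rule tendsto_imp_eventually_ne) simp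
  then have "\<forall>\<^sub>F n in sequentially. u (n - 1) \<noteq> 0"
    by (rule eventually_compose_filterlim) (rule filterlim_minus_const_nat_at_top)
  then have "\<forall>\<^sub>F n in sequentially. u (n - 1) * (u n / u (n - 1)) = u n"
    by eventually_elim simp
  moreover have "has_asymp_power_series (\<lambda>n. u (n - 1) * (u n / u (n - 1)))
      (\<lambda>k. \<Sum>i\<le>k. c_coeff b i * a (k - i))"
    using has_asymp_power_series_mult[OF shift] quot unfolding u_def .
  ultimately have "has_asymp_power_series u (\<lambda>k. \<Sum>i\<le>k. c_coeff b i * a (k - i))"
    by (rule has_asymp_power_series_cong)
  with u have coeff: "b k = (\<Sum>i\<le>k. c_coeff b i * a (k - i))" for k
    by (rule has_asymp_power_series_unique)
  have rec: "b k = - (1 / real k) *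
       ((\<Sum>j=0..k - 1. c_coeff b j * a (k + 1 - j)) +
        (\<Sum>j=1..k - 1. real (k choose (j - 1)) * b j))" if k1: "k \<ge> 1" for k
  proof -
    obtain l where k: "k = Suc l"
      using k1 by (cases k) auto
    let ?S = "\<Sum>j\<le>l. c_coeff b j * a (k + 1 - j)"
    let ?T = "\<Sum>j<l. real (k choose j) * b (Suc j)"
    have "b (Suc k) = ?S + c_coeff b (Suc k)"
      using coeff[of "Suc k"] a0 a1 by (simp add: k)
    \<comment> \<open>The two highest terms of \<open>c_coeff b (Suc k)\<close> carry the binomials \<open>k choose (k - 1)\<close> and
        \<open>k choose k\<close>; the former is what makes \<open>b k\<close> appear with the factor \<open>k\<close>.\<close>
    also have "c_coeff b (Suc k) = ?T + real k * b k + b (Suc k)"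
      by (simp add: c_coeff_Suc k lessThan_Suc_atMost[symmetric])
    finally have "real k * b k = - (?S + ?T)"
      by simp
    moreover have "(\<Sum>j=1..k - 1. real (k choose (j - 1)) * b j) = ?T"
      by (rule sum.reindex_bij_witness[of _ Suc "\<lambda>j. j - 1"]) (auto simp: k)
    ultimately show ?thesis
      by (simp add: k atLeast0AtMost field_simps)
  qed
  have "b 1 = - a 2"
    using rec[of 1] by (simp add: c_coeff_def numeral_2_eq_2)
  with b0 rec show ?thesis
    by simp
qed

end
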